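(* (Simplex Lemma II) Let $P$ be a finite set of points in $\mathbb{R}^d$ with a partition $P=\bigcup_{l=1}^j P_l$ into nonempty sets, $P_{l_1}\cap P_{l_2}=\emptyset$ for any $l_1\ne l_2$. Let $o$ be the mean point of $P$, $o_l$ be the mean point of $P_l$ for $1\le l\le j$, and $\delta^2=\frac{1}{|P|}\sum_{p\in P}\|p-o\|^2$, $\delta\ge 0$. Let $\{o'_1,\dots,o'_j\}$ be $j$ points in $\mathbb{R}^d$ such that $\|o'_l-o_l\|\le L$ for $1\le l\le j$, where $L>0$, and let $V'$ be the simplex determined by $\{o'_1,\dots,o'_j\}$. Then for any $0<\epsilon\le 1$, it is possible to construct (from $o'_1,\dots,o'_j$ and $\epsilon$ only, without knowledge of $P$ and its partition) a grid of size $O((8j/\epsilon)^j)$ inside $V'$ such that at least one grid point $\tau$ satisfies $\|\tau-o\|\le\sqrt{\epsilon}\,\delta+(1+\epsilon)L$.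
   Context: The mean point of a finite nonempty set $Q\subset\mathbb{R}^d$ is $\frac{1}{|Q|}\sum_{q\in Q}q$. The simplex determined by $\{o'_1,\dots,o'_j\}$ is their convex hull (possibly degenerate). A grid of size $N$ means a finite set of $N$ points. The set $P$ is regarded as unknown; the only known information is the points $o'_1,\dots,o'_j$. Equivalently, one grid built from $(o'_1,\dots,o'_j,\epsilon)$ must work for all admissible $P$, partitions and $L$. *)

theory Defs
  imports "HOL-Analysis.Analysis" "HOL-Library.Function_Algebras"
begin

text \<open>
  The constant hidden in \<open>O((8j/\<epsilon>)^j)\<close> must not depend on the dimension \<open>d\<close>, so \<open>d\<close> has to be
  quantified inside the formula and cannot be a type. All spaces \<open>\<real>\<^sup>d\<close> are therefore realised
  inside the single vector space \<open>nat \<Rightarrow> real\<close> with pointwise operations; the instance below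
  makes the library's linear algebra (in particular \<open>convex hull\<close>) available there.
\<close>

instantiation "fun" :: (type, real_vector) real_vector
begin

definition scaleR_fun :: "real \<Rightarrow> ('a \<Rightarrow> 'b) \<Rightarrow> 'a \<Rightarrow> 'b"
  where "scaleR_fun r f = (\<lambda>i. r *\<^sub>R f i)"

instance
  by standard (simp_all add: scaleR_fun_def fun_eq_iff scaleR_add_right scaleR_add_left)

end

text \<open>\<open>\<real>\<^sup>d\<close>, with coordinates \<open>0, \<dots>, d - 1\<close>; the junk coordinates are set to zero so that
  distinct elements are distinct points (this matters for cardinalities).\<close>

definition Rspace :: "nat \<Rightarrow> (nat \<Rightarrow> real) set"
  where "Rspace d = {x. \<forall>i\<ge>d. x i = 0}"

definition enorm :: "nat \<Rightarrow> (nat \<Rightarrow> real) \<Rightarrow> real"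
  where "enorm d x = L2_set x {..<d}"

definition mean_point :: "'a::real_vector set \<Rightarrow> 'a"
  where "mean_point Q = (1 / real (card Q)) *\<^sub>R (\<Sum>q\<in>Q. q)"

end

theory Submission
  imports Defs
begin

text \<open>
  Write \<open>w\<^sub>l = |P\<^sub>l| / |P|\<close>, so that \<open>o = \<Sum> w\<^sub>l o\<^sub>l\<close> and \<open>\<Sum> w\<^sub>l \<parallel>o\<^sub>l - o\<parallel>\<^sup>2 \<le> \<delta>\<^sup>2\<close>. With \<open>K = 4j/\<epsilon>\<close>,
  the grid consists of the points \<open>\<Sum> v\<^sub>l o'\<^sub>l\<close> where \<open>v = n / \<Sum> n\<^sub>l\<close> for integer vectors
  \<open>0 \<le> n\<^sub>l \<le> K\<close>. Take \<open>n\<^sub>l = \<lfloor>K w\<^sub>l\<rfloor>\<close> and \<open>s = \<Sum> n\<^sub>l / K\<close>; then \<open>1 - \<epsilon>/4 \<le> s \<le> 1\<close>. The error splits as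
  \<open>\<tau> - o = \<Sum> v\<^sub>l (o'\<^sub>l - o\<^sub>l) + \<Sum> v\<^sub>l (o\<^sub>l - o)\<close>. The first part has norm at most \<open>L\<close>. Since
  \<open>\<Sum> w\<^sub>l (o\<^sub>l - o) = 0\<close>, the second part is \<open>- \<Sum> u\<^sub>l (o\<^sub>l - o)\<close> with \<open>u\<^sub>l = w\<^sub>l/s - v\<^sub>l\<close>, and \<open>0 \<le> u\<^sub>l \<le> w\<^sub>l/s\<close>,
  \<open>\<Sum> u\<^sub>l = 1/s - 1\<close>, so by Cauchy-Schwarz its squared norm is at most \<open>(1/s - 1) \<delta>\<^sup>2/s \<le> \<epsilon> \<delta>\<^sup>2\<close>.
\<close>

section \<open>Weighted sums and the Euclidean norm\<close>

lemma sum_scaleR_fun_apply: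
  fixes a :: "'i \<Rightarrow> 'k \<Rightarrow> 'v::real_vector"
  shows "(\<Sum>l\<in>A. u l *\<^sub>R a l) i = (\<Sum>l\<in>A. u l *\<^sub>R a l i)"
  by (induction A rule: infinite_finite_induct) (auto simp: scaleR_fun_def zero_fun_def)

lemma enorm_nonneg: "0 \<le> enorm d x"
  by (simp add: enorm_def)

lemma enorm_power2: "(enorm d x)\<^sup>2 = (\<Sum>i<d. (x i)\<^sup>2)"
  by (simp add: enorm_def L2_set_def sum_nonneg)

lemma enorm_triangle: "enorm d (x + y) \<le> enorm d x + enorm d y"
  using L2_set_triangle_ineq[of x y "{..<d}"] by (simp add: enorm_def plus_fun_def)

lemma enorm_minus: "enorm d (- x) = enorm d x"
  by (simp add: enorm_def L2_set_def)

text \<open>Each weight is split into two square roots. The total \<open>sum u A\<close> stays as a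
  factor, since the rounding estimate draws its small factor from it.\<close>

lemma weighted_Cauchy_Schwarz:
  fixes u x :: "'i \<Rightarrow> real"
  assumes "\<And>l. l \<in> A \<Longrightarrow> 0 \<le> u l"
  shows "(\<Sum>l\<in>A. u l * x l)\<^sup>2 \<le> sum u A * (\<Sum>l\<in>A. u l * (x l)\<^sup>2)"
proof -
  have "(\<Sum>l\<in>A. sqrt (u l) * (sqrt (u l) * x l))\<^sup>2
      \<le> (\<Sum>l\<in>A. (sqrt (u l))\<^sup>2) * (\<Sum>l\<in>A. (sqrt (u l) * x l)\<^sup>2)"
    by (rule Cauchy_Schwarz_ineq_sum)
  also have "(\<Sum>l\<in>A. sqrt (u l) * (sqrt (u l) * x l)) = (\<Sum>l\<in>A. u l * x l)"
    using assms by (intro sum.cong) (auto simp flip: mult.assoc)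
  also have "(\<Sum>l\<in>A. (sqrt (u l))\<^sup>2) = sum u A"
    using assms by (intro sum.cong) auto
  also have "(\<Sum>l\<in>A. (sqrt (u l) * x l)\<^sup>2) = (\<Sum>l\<in>A. u l * (x l)\<^sup>2)"
    using assms by (intro sum.cong) (auto simp: power_mult_distrib)
  finally show ?thesis .
qed

text \<open>The weighted Cauchy-Schwarz inequality in each coordinate, then an exchange of sums. It
  serves for convex weights, for uniform weights on a point set and for the rounding error, whose
  total is small.\<close>

lemma enorm_weighted_sum_power2_le:
  assumes "\<And>l. l \<in> A \<Longrightarrow> 0 \<le> u l"
  shows "(enorm d (\<Sum>l\<in>A. u l *\<^sub>R a l))\<^sup>2 \<le> sum u A * (\<Sum>l\<in>A. u l * (enorm d (a l))\<^sup>2)"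
proof -
  have "(enorm d (\<Sum>l\<in>A. u l *\<^sub>R a l))\<^sup>2 = (\<Sum>i<d. (\<Sum>l\<in>A. u l * a l i)\<^sup>2)"
    by (simp add: enorm_power2 sum_scaleR_fun_apply)
  also have "\<dots> \<le> (\<Sum>i<d. sum u A * (\<Sum>l\<in>A. u l * (a l i)\<^sup>2))"
    by (intro sum_mono weighted_Cauchy_Schwarz assms)
  also have "\<dots> = sum u A * (\<Sum>l\<in>A. u l * (enorm d (a l))\<^sup>2)"
    by (simp add: enorm_power2 sum_distrib_left sum.swap[of _ "{..<d}"])
  finally show ?thesis .
qed

lemma enorm_convex_combination_le:
  assumes "\<And>l. l \<in> A \<Longrightarrow> 0 \<le> v l" "sum v A = 1"
    and "\<And>l. l \<in> A \<Longrightarrow> enorm d (a l) \<le> L" "0 \<le> L"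
  shows "enorm d (\<Sum>l\<in>A. v l *\<^sub>R a l) \<le> L"
proof (rule power2_le_imp_le)
  have "(enorm d (\<Sum>l\<in>A. v l *\<^sub>R a l))\<^sup>2 \<le> sum v A * (\<Sum>l\<in>A. v l * (enorm d (a l))\<^sup>2)"
    by (rule enorm_weighted_sum_power2_le) (rule assms(1))
  also have "\<dots> \<le> 1 * (\<Sum>l\<in>A. v l * L\<^sup>2)"
    unfolding assms(2)
    by (intro mult_left_mono sum_mono power_mono) (use assms enorm_nonneg in auto)
  also have "\<dots> = L\<^sup>2"
    by (simp add: assms(2) flip: sum_distrib_right)
  finally show "(enorm d (\<Sum>l\<in>A. v l *\<^sub>R a l))\<^sup>2 \<le> L\<^sup>2" .
qed fact

section \<open>Mean points and the weights of a partition\<close>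

lemma card_scaleR_mean_point:
  assumes "finite Q" "Q \<noteq> {}"
  shows "real (card Q) *\<^sub>R mean_point Q = \<Sum>Q"
  using assms by (simp add: mean_point_def)

text \<open>Convexity of the squared norm, with uniform weights on \<open>Q\<close>:
  \<open>mean_point Q - x\<close> is the average of the vectors \<open>q - x\<close>.\<close>

lemma card_times_enorm_mean_point_le:
  assumes "finite Q" "Q \<noteq> {}"
  shows "real (card Q) * (enorm d (mean_point Q - x))\<^sup>2 \<le> (\<Sum>q\<in>Q. (enorm d (q - x))\<^sup>2)"
proof -
  define m where "m = real (card Q)"
  have m: "m > 0" using assms by (simp add: m_def card_gt_0_iff)
  have "(\<Sum>q\<in>Q. (1 / m) *\<^sub>R (q - x)) = (1 / m) *\<^sub>R \<Sum>Q - (\<Sum>q\<in>Q. (1 / m) *\<^sub>R x)"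
    by (simp add: scaleR_diff_right sum_subtractf scaleR_sum_right)
  also have "(\<Sum>q\<in>Q. (1 / m) *\<^sub>R x) = (\<Sum>q\<in>Q. 1 / m) *\<^sub>R x"
    by (rule scaleR_sum_left[symmetric])
  also have "\<dots> = x"
    using m by (simp add: m_def)
  finally have *: "(\<Sum>q\<in>Q. (1 / m) *\<^sub>R (q - x)) = mean_point Q - x"
    by (simp only: mean_point_def m_def)
  have "(enorm d (mean_point Q - x))\<^sup>2
      \<le> (\<Sum>q\<in>Q. 1 / m) * (\<Sum>q\<in>Q. 1 / m * (enorm d (q - x))\<^sup>2)"
    unfolding *[symmetric] by (rule enorm_weighted_sum_power2_le) (use m in auto)
  also have "\<dots> = (\<Sum>q\<in>Q. (enorm d (q - x))\<^sup>2) / m"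
    using m by (simp add: m_def sum_divide_distrib)
  finally show ?thesis
    using m by (simp add: m_def field_simps)
qed

text \<open>The last claim says that the variance between the classes is at most the total variance;
  it follows by applying the convexity bound to each class with \<open>x\<close> the overall
  mean.\<close>

lemma partition_weights:
  fixes Pl :: "'i \<Rightarrow> (nat \<Rightarrow> real) set"
  assumes P: "finite P" "P = (\<Union>l\<in>A. Pl l)" and A: "finite A" "A \<noteq> {}"
    and ne: "\<And>l. l \<in> A \<Longrightarrow> Pl l \<noteq> {}" and disj: "disjoint_family_on Pl A"
  defines "w \<equiv> \<lambda>l. real (card (Pl l)) / real (card P)"
  defines "a \<equiv> \<lambda>l. mean_point (Pl l) - mean_point P"
  shows "sum w A = 1" "(\<Sum>l\<in>A. w l *\<^sub>R a l) = 0"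
    and "(\<Sum>l\<in>A. w l * (enorm d (a l))\<^sup>2)
      \<le> (1 / real (card P)) * (\<Sum>p\<in>P. (enorm d (p - mean_point P))\<^sup>2)"
proof -
  have fin: "finite (Pl l)" if "l \<in> A" for l
    using P that by (auto intro: finite_subset)
  have "P \<noteq> {}" using P A ne by auto
  hence m: "real (card P) > 0" using P(1) by (simp add: card_gt_0_iff)
  \<comment> \<open>Kept polymorphic: it is applied to the constant 1 for cardinalities, to the
    points themselves for the mean, and to squared distances.\<close>
  have split: "sum f P = (\<Sum>l\<in>A. sum f (Pl l))" for f :: "_ \<Rightarrow> 'b::comm_monoid_add"
    unfolding P(2) using A fin disj
    by (intro sum.UNION_disjoint) (auto simp: disjoint_family_on_def)
  have "real (card P) = (\<Sum>l\<in>A. real (card (Pl l)))"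
    using split[of "\<lambda>_. 1::real"] by simp
  thus w1: "sum w A = 1"
    using m by (simp add: w_def flip: sum_divide_distrib)
  have "(\<Sum>l\<in>A. w l *\<^sub>R mean_point (Pl l)) = (1 / real (card P)) *\<^sub>R (\<Sum>l\<in>A. \<Sum>(Pl l))"
    unfolding scaleR_sum_right[of _ _ A]
    by (intro sum.cong refl) (simp add: w_def flip: card_scaleR_mean_point[OF fin ne])
  also have "\<dots> = mean_point P"
    by (simp add: mean_point_def split)
  finally show "(\<Sum>l\<in>A. w l *\<^sub>R a l) = 0"
    by (simp add: a_def scaleR_diff_right sum_subtractf w1 flip: scaleR_sum_left)
  have "(\<Sum>l\<in>A. w l * (enorm d (a l))\<^sup>2)
      = (1 / real (card P)) * (\<Sum>l\<in>A. real (card (Pl l)) * (enorm d (a l))\<^sup>2)"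
    by (simp add: w_def sum_distrib_left)
  also have "\<dots> \<le> (1 / real (card P)) * (\<Sum>l\<in>A. \<Sum>p\<in>Pl l. (enorm d (p - mean_point P))\<^sup>2)"
    unfolding a_def by (intro mult_left_mono sum_mono card_times_enorm_mean_point_le fin ne) auto
  finally show "(\<Sum>l\<in>A. w l * (enorm d (a l))\<^sup>2)
      \<le> (1 / real (card P)) * (\<Sum>p\<in>P. (enorm d (p - mean_point P))\<^sup>2)"
    by (simp add: split)
qed

section \<open>Rounding the weights\<close>

text \<open>A small total rounding error alone would not suffice, since a class of tiny weight may
  have its mean far from the overall mean. The error \<open>u\<close> is also dominated by
  \<open>w / s\<close>, so its second moment is controlled by the variance; the product of both
  bounds is of order \<epsilon> times the squared \<delta>.\<close>

lemma rounded_weights: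
  fixes w :: "'i \<Rightarrow> real"
  assumes A: "finite A" and w: "\<And>l. l \<in> A \<Longrightarrow> 0 \<le> w l" "sum w A = 1"
    and a0: "(\<Sum>l\<in>A. w l *\<^sub>R a l) = 0" and var: "(\<Sum>l\<in>A. w l * (enorm d (a l))\<^sup>2) \<le> \<delta>\<^sup>2"
    and \<delta>: "0 \<le> \<delta>" and \<epsilon>: "0 < \<epsilon>" "\<epsilon> \<le> 1"
  defines "n \<equiv> \<lambda>l. nat \<lfloor>4 * real (card A) / \<epsilon> * w l\<rfloor>"
  shows "0 < sum n A"
    and "enorm d (\<Sum>l\<in>A. (real (n l) / real (sum n A)) *\<^sub>R a l) \<le> sqrt \<epsilon> * \<delta>"
proof -
  have "A \<noteq> {}" using w(2) by auto
  hence c: "real (card A) > 0" using A by (simp add: card_gt_0_iff)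
  define K where "K = 4 * real (card A) / \<epsilon>"
  have K: "K > 0" using c \<epsilon> by (simp add: K_def)
  have n_le: "real (n l) \<le> K * w l" and n_ge: "K * w l - 1 \<le> real (n l)" if "l \<in> A" for l
  proof -
    \<comment> \<open>As \<open>K * w l\<close> is nonnegative, \<open>nat\<close> does not alter
      the floor.\<close>
    have "real (n l) = of_int \<lfloor>K * w l\<rfloor>"
      using w(1)[OF that] K unfolding n_def K_def[symmetric] by (intro of_nat_nat) simp
    thus "real (n l) \<le> K * w l" "K * w l - 1 \<le> real (n l)" by linarith+
  qed
  define s where "s = real (sum n A) / K"
  have "(\<Sum>l\<in>A. K * w l - 1) \<le> (\<Sum>l\<in>A. real (n l))"
    by (intro sum_mono n_ge)
  hence "K - real (card A) \<le> real (sum n A)"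
    by (simp add: sum_subtractf w(2) flip: sum_distrib_left)
  \<comment> \<open>Rounding down loses at most 1 per index, hence at most \<open>card A\<close> in
    total; the 4 in \<open>K\<close> turns this into a fraction \<epsilon>/4 of
    \<open>K\<close>.\<close>
  moreover have "real (card A) = \<epsilon> / 4 * K"
    using \<epsilon> by (simp add: K_def)
  ultimately have "(1 - \<epsilon> / 4) * K \<le> s * K"
    using K by (simp add: s_def algebra_simps)
  hence s_ge: "1 - \<epsilon> / 4 \<le> s" using K by simp
  hence s: "s \<ge> 3 / 4" using \<epsilon> by simp
  thus "0 < sum n A"
    using K by (intro Nat.gr0I) (auto simp: s_def)
  define v where "v = (\<lambda>l. real (n l) / real (sum n A))"
  have v_eq: "v l = real (n l) / K / s" for l
    using K by (simp add: v_def s_def)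
  have sum_v: "sum v A = 1"
    using \<open>0 < sum n A\<close> by (simp add: v_def flip: sum_divide_distrib of_nat_sum)
  \<comment> \<open>Dividing \<open>w\<close> by \<open>s\<close> before subtracting gives both
    vectors equal denominators: \<open>v l\<close> is \<open>n l / K / s\<close>. Since floors only
    round down, the difference is nonnegative, as Cauchy-Schwarz with weights \<open>u\<close>
    requires.\<close>
  define u where "u = (\<lambda>l. w l / s - v l)"
  have u0: "0 \<le> u l" if "l \<in> A" for l
  proof -
    have "real (n l) / K \<le> w l" using n_le[OF that] K by (simp add: field_simps)
    hence "v l \<le> w l / s" unfolding v_eq using s by (intro divide_right_mono) auto
    thus ?thesis by (simp add: u_def)
  qed
  have "0 \<le> v l" for l by (simp add: v_def sum_nonneg)
  hence u_le: "u l \<le> w l / s" for l by (simp add: u_def)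
  have sum_u: "sum u A = 1 / s - 1"
    by (simp add: u_def sum_subtractf sum_v w(2) flip: sum_divide_distrib)
  have "(\<Sum>l\<in>A. u l *\<^sub>R a l) = (1 / s) *\<^sub>R (\<Sum>l\<in>A. w l *\<^sub>R a l) - (\<Sum>l\<in>A. v l *\<^sub>R a l)"
    by (simp add: u_def scaleR_diff_left sum_subtractf scaleR_sum_right)
  hence v_u: "(\<Sum>l\<in>A. v l *\<^sub>R a l) = - (\<Sum>l\<in>A. u l *\<^sub>R a l)"
    by (simp add: a0)
  have "(enorm d (\<Sum>l\<in>A. u l *\<^sub>R a l))\<^sup>2 \<le> sum u A * (\<Sum>l\<in>A. u l * (enorm d (a l))\<^sup>2)"
    by (rule enorm_weighted_sum_power2_le) (rule u0)
  also have "\<dots> \<le> sum u A * (\<Sum>l\<in>A. w l / s * (enorm d (a l))\<^sup>2)"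
    by (intro mult_left_mono sum_mono mult_right_mono u_le sum_nonneg u0) auto
  also have "\<dots> = sum u A / s * (\<Sum>l\<in>A. w l * (enorm d (a l))\<^sup>2)"
    by (simp add: sum_distrib_left mult.assoc)
  also have "\<dots> \<le> sum u A / s * \<delta>\<^sup>2"
    using s by (intro mult_left_mono var divide_nonneg_nonneg sum_nonneg u0) auto
  also have "\<dots> \<le> \<epsilon> * \<delta>\<^sup>2"
  proof (intro mult_right_mono)
    \<comment> \<open>With \<open>sum u A = 1 / s - 1\<close> the goal amounts to
      \<open>1 - s\<close> being at most \<epsilon> times \<open>s * s\<close>. The left side is at
      most \<epsilon>/4, while \<open>s * s\<close> is at least 9/16.\<close>
    have "1 - s \<le> \<epsilon> * (3 / 4 * (3 / 4))" using s_ge \<epsilon> by simp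
    also have "\<dots> \<le> \<epsilon> * (s * s)"
      using s \<epsilon> by (intro mult_left_mono mult_mono) auto
    finally show "sum u A / s \<le> \<epsilon>"
      using s by (simp add: sum_u field_simps)
  qed auto
  also have "\<dots> = (sqrt \<epsilon> * \<delta>)\<^sup>2"
    using \<epsilon> by (simp add: power_mult_distrib)
  finally have "enorm d (\<Sum>l\<in>A. u l *\<^sub>R a l) \<le> sqrt \<epsilon> * \<delta>"
    using \<delta> \<epsilon> by (elim power2_le_imp_le) simp
  thus "enorm d (\<Sum>l\<in>A. (real (n l) / real (sum n A)) *\<^sub>R a l) \<le> sqrt \<epsilon> * \<delta>"
    using v_u by (simp add: v_def enorm_minus)
qed

section \<open>The grid of rational convex combinations\<close>

text \<open>Dividing by \<open>sum n A\<close>, whatever its value, makes every point a convex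
  combination of the \<open>c l\<close>. The zero vector is excluded because division by zero would
  yield the origin, possibly outside the simplex. Extensional functions make the index set
  finite.\<close>

definition weight_grid :: "nat \<Rightarrow> 'i set \<Rightarrow> ('i \<Rightarrow> 'v::real_vector) \<Rightarrow> 'v set"
  where "weight_grid M A c = (\<lambda>n. \<Sum>l\<in>A. (real (n l) / real (sum n A)) *\<^sub>R c l) `
    {n \<in> A \<rightarrow>\<^sub>E {..M}. 0 < sum n A}"

lemma finite_weight_grid:
  assumes "finite A"
  shows "finite (weight_grid M A c)"
  unfolding weight_grid_def using assms
  by (intro finite_imageI finite_Collect_conjI disjI1) (simp add: finite_PiE)

text \<open>Counting index vectors gives only an upper bound: proportional vectors, for instance,
  yield the same point.\<close>

lemma card_weight_grid_le:
  assumes "finite A"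
  shows "card (weight_grid M A c) \<le> (M + 1) ^ card A"
proof -
  have fin: "finite (A \<rightarrow>\<^sub>E {..M})" using assms by (simp add: finite_PiE)
  have "card (weight_grid M A c) \<le> card {n \<in> A \<rightarrow>\<^sub>E {..M}. 0 < sum n A}"
    unfolding weight_grid_def by (intro card_image_le finite_subset[OF _ fin]) auto
  also have "\<dots> \<le> card (A \<rightarrow>\<^sub>E {..M})"
    by (intro card_mono fin) auto
  also have "\<dots> = (M + 1) ^ card A"
    using assms by (simp add: card_PiE)
  finally show ?thesis .
qed

lemma weight_grid_subset_convex_hull:
  assumes "finite A"
  shows "weight_grid M A c \<subseteq> convex hull (c ` A)"
proof
  fix x assume "x \<in> weight_grid M A c"
  then obtain n where n: "0 < sum n A"
    and x: "x = (\<Sum>l\<in>A. (real (n l) / real (sum n A)) *\<^sub>R c l)"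
    unfolding weight_grid_def by auto
  have "(\<Sum>l\<in>A. real (n l) / real (sum n A)) = 1"
    using n by (simp flip: sum_divide_distrib of_nat_sum)
  thus "x \<in> convex hull (c ` A)"
    unfolding x using assms
    by (intro convex_sum) (auto intro!: hull_inc divide_nonneg_nonneg sum_nonneg)
qed

text \<open>The same convex weights \<open>v\<close> are put on the given points and on the true
  class means. The displacements then average to at most \<open>L\<close>, and what remains is the
  rounding error of the exact weights.\<close>

lemma weight_grid_near_mean_point:
  fixes Pl :: "'i \<Rightarrow> (nat \<Rightarrow> real) set"
  assumes P: "finite P" "P = (\<Union>l\<in>A. Pl l)" and A: "finite A" "A \<noteq> {}"
    and ne: "\<And>l. l \<in> A \<Longrightarrow> Pl l \<noteq> {}" and disj: "disjoint_family_on Pl A"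
    and \<delta>: "0 \<le> \<delta>" "\<delta>\<^sup>2 = (1 / real (card P)) * (\<Sum>p\<in>P. (enorm d (p - mean_point P))\<^sup>2)"
    and L: "0 \<le> L" "\<And>l. l \<in> A \<Longrightarrow> enorm d (c l - mean_point (Pl l)) \<le> L"
    and \<epsilon>: "0 < \<epsilon>" "\<epsilon> \<le> 1"
  shows "\<exists>\<tau>\<in>weight_grid (nat \<lfloor>4 * real (card A) / \<epsilon>\<rfloor>) A c.
    enorm d (\<tau> - mean_point P) \<le> sqrt \<epsilon> * \<delta> + L"
proof -
  define w where "w = (\<lambda>l. real (card (Pl l)) / real (card P))"
  define a where "a = (\<lambda>l. mean_point (Pl l) - mean_point P)"
  have pw: "sum w A = 1" "(\<Sum>l\<in>A. w l *\<^sub>R a l) = 0" "(\<Sum>l\<in>A. w l * (enorm d (a l))\<^sup>2) \<le> \<delta>\<^sup>2"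
    unfolding w_def a_def \<delta>(2)
    using partition_weights[OF P A _ disj] ne by blast+
  have w0: "0 \<le> w l" for l by (simp add: w_def)
  have w_le: "w l \<le> 1" if "l \<in> A" for l
    using member_le_sum[OF that, of w] A w0 pw(1) by simp
  define n where "n = (\<lambda>l. nat \<lfloor>4 * real (card A) / \<epsilon> * w l\<rfloor>)"
  define v where "v = (\<lambda>l. real (n l) / real (sum n A))"
  have n_pos: "0 < sum n A" and err: "enorm d (\<Sum>l\<in>A. v l *\<^sub>R a l) \<le> sqrt \<epsilon> * \<delta>"
    using rounded_weights[OF A(1) w0 pw \<delta>(1) \<epsilon>]
    by (simp_all add: n_def v_def)
  have sum_v: "sum v A = 1"
    using n_pos by (simp add: v_def flip: sum_divide_distrib of_nat_sum)
  define \<tau> where "\<tau> = (\<Sum>l\<in>A. v l *\<^sub>R c l)"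
  \<comment> \<open>No weight exceeds 1, so a range of integers fixed by \<open>card A\<close> and
    \<epsilon> alone contains every rounded weight.\<close>
  have n_le: "n l \<le> nat \<lfloor>4 * real (card A) / \<epsilon>\<rfloor>" if "l \<in> A" for l
    unfolding n_def using w_le[OF that] \<epsilon>
    by (intro nat_mono floor_mono mult_left_le) auto
  have grid: "\<tau> \<in> weight_grid (nat \<lfloor>4 * real (card A) / \<epsilon>\<rfloor>) A c"
    unfolding weight_grid_def
  \<comment> \<open>Grid indices are extensional, whereas \<open>n\<close> also takes values off
    \<open>A\<close>; restricting it leaves the sums over \<open>A\<close> unchanged.\<close>
  proof (rule image_eqI)
    show "\<tau> = (\<Sum>l\<in>A. (real (restrict n A l) / real (sum (restrict n A) A)) *\<^sub>R c l)"
      by (simp add: \<tau>_def v_def)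
    show "restrict n A \<in> {n \<in> A \<rightarrow>\<^sub>E {..nat \<lfloor>4 * real (card A) / \<epsilon>\<rfloor>}. 0 < sum n A}"
      using n_le n_pos by (auto simp: restrict_PiE_iff)
  qed
  have "\<tau> - mean_point P
      = (\<Sum>l\<in>A. v l *\<^sub>R (c l - mean_point (Pl l))) + (\<Sum>l\<in>A. v l *\<^sub>R a l)"
    by (simp add: \<tau>_def a_def scaleR_diff_right sum_subtractf sum_v flip: scaleR_sum_left)
  hence "enorm d (\<tau> - mean_point P)
      \<le> enorm d (\<Sum>l\<in>A. v l *\<^sub>R (c l - mean_point (Pl l))) + enorm d (\<Sum>l\<in>A. v l *\<^sub>R a l)"
    by (simp only: enorm_triangle)
  moreover have "enorm d (\<Sum>l\<in>A. v l *\<^sub>R (c l - mean_point (Pl l))) \<le> L"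
    by (intro enorm_convex_combination_le sum_v L) (simp_all add: v_def sum_nonneg)
  ultimately have "enorm d (\<tau> - mean_point P) \<le> sqrt \<epsilon> * \<delta> + L"
    using err by linarith
  thus ?thesis using grid by (rule bexI)
qed

theorem lemma6:
  "\<exists>C::real. C > 0 \<and>
    (\<forall>(d::nat) (j::nat) (c' :: nat \<Rightarrow> (nat \<Rightarrow> real)) (\<epsilon>::real).
      j \<ge> 1 \<and> (\<forall>l\<in>{1..j}. c' l \<in> Rspace d) \<and> 0 < \<epsilon> \<and> \<epsilon> \<le> 1 \<longrightarrow>
      (\<exists>G :: (nat \<Rightarrow> real) set.
        finite G \<and> real (card G) \<le> C * (8 * real j / \<epsilon>) ^ j \<and>
        G \<subseteq> convex hull (c' ` {1..j}) \<and>
        (\<forall>(P :: (nat \<Rightarrow> real) set) (Pl :: nat \<Rightarrow> (nat \<Rightarrow> real) set) (\<delta>::real) (L::real).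
          finite P \<and> P \<subseteq> Rspace d \<and>
          P = (\<Union>l\<in>{1..j}. Pl l) \<and>
          (\<forall>l\<in>{1..j}. Pl l \<noteq> {}) \<and>
          disjoint_family_on Pl {1..j} \<and>
          \<delta> \<ge> 0 \<and>
          \<delta>\<^sup>2 = (1 / real (card P)) * (\<Sum>p\<in>P. (enorm d (p - mean_point P))\<^sup>2) \<and>
          L > 0 \<and>
          (\<forall>l\<in>{1..j}. enorm d (c' l - mean_point (Pl l)) \<le> L) \<longrightarrow>
          (\<exists>\<tau>\<in>G. enorm d (\<tau> - mean_point P) \<le> sqrt \<epsilon> * \<delta> + (1 + \<epsilon>) * L))))"
proof (intro exI[of _ "1::real"] conjI allI impI)
  fix d j :: nat and c' :: "nat \<Rightarrow> nat \<Rightarrow> real" and \<epsilon> :: real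
  assume asm: "j \<ge> 1 \<and> (\<forall>l\<in>{1..j}. c' l \<in> Rspace d) \<and> 0 < \<epsilon> \<and> \<epsilon> \<le> 1"
  define M where "M = nat \<lfloor>4 * real j / \<epsilon>\<rfloor>"
  let ?G = "weight_grid M {1..j} c'"
  \<comment> \<open>This absorbs the extra value 0 among the \<open>M + 1\<close> choices per
    coordinate: 4 + 1 multiples of \<open>real j\<close> / \<epsilon> are at most 8, so the hidden
    constant can be 1.\<close>
  have "1 \<le> real j / \<epsilon>" using asm by (simp add: field_simps)
  moreover have "real M \<le> 4 * real j / \<epsilon>" using asm by (simp add: M_def)
  ultimately have M: "real (M + 1) \<le> 8 * real j / \<epsilon>" by simp
  show "\<exists>G. finite G \<and> real (card G) \<le> 1 * (8 * real j / \<epsilon>) ^ j \<and>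
      G \<subseteq> convex hull (c' ` {1..j}) \<and>
      (\<forall>P Pl \<delta> L.
        finite P \<and> P \<subseteq> Rspace d \<and> P = (\<Union>l\<in>{1..j}. Pl l) \<and> (\<forall>l\<in>{1..j}. Pl l \<noteq> {}) \<and>
        disjoint_family_on Pl {1..j} \<and> \<delta> \<ge> 0 \<and>
        \<delta>\<^sup>2 = (1 / real (card P)) * (\<Sum>p\<in>P. (enorm d (p - mean_point P))\<^sup>2) \<and>
        L > 0 \<and> (\<forall>l\<in>{1..j}. enorm d (c' l - mean_point (Pl l)) \<le> L) \<longrightarrow>
        (\<exists>\<tau>\<in>G. enorm d (\<tau> - mean_point P) \<le> sqrt \<epsilon> * \<delta> + (1 + \<epsilon>) * L))"
  proof (intro exI[of _ ?G] conjI allI impI)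
    show "finite ?G" by (simp add: finite_weight_grid)
    have "real (card ?G) \<le> real (M + 1) ^ j"
      using card_weight_grid_le[of "{1..j}" M c'] by (simp flip: of_nat_power of_nat_Suc)
    also have "\<dots> \<le> (8 * real j / \<epsilon>) ^ j"
      by (intro power_mono M) simp
    finally show "real (card ?G) \<le> 1 * (8 * real j / \<epsilon>) ^ j" by simp
    show "?G \<subseteq> convex hull (c' ` {1..j})" by (simp add: weight_grid_subset_convex_hull)
  next
    fix P Pl and \<delta> L :: real
    assume h: "finite P \<and> P \<subseteq> Rspace d \<and> P = (\<Union>l\<in>{1..j}. Pl l) \<and> (\<forall>l\<in>{1..j}. Pl l \<noteq> {}) \<and>
        disjoint_family_on Pl {1..j} \<and> \<delta> \<ge> 0 \<and>
        \<delta>\<^sup>2 = (1 / real (card P)) * (\<Sum>p\<in>P. (enorm d (p - mean_point P))\<^sup>2) \<and>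
        L > 0 \<and> (\<forall>l\<in>{1..j}. enorm d (c' l - mean_point (Pl l)) \<le> L)"
    have "\<exists>\<tau>\<in>weight_grid (nat \<lfloor>4 * real (card {1..j}) / \<epsilon>\<rfloor>) {1..j} c'.
        enorm d (\<tau> - mean_point P) \<le> sqrt \<epsilon> * \<delta> + L"
    proof (rule weight_grid_near_mean_point[where Pl = Pl])
      show "finite {1..j}" "{1..j} \<noteq> {}" using asm by simp_all
      show "0 \<le> L" using h by linarith
    qed (use h asm in blast)+
    then obtain \<tau> where "\<tau> \<in> ?G" "enorm d (\<tau> - mean_point P) \<le> sqrt \<epsilon> * \<delta> + L"
      by (auto simp: M_def)
    moreover have "L \<le> (1 + \<epsilon>) * L" using h asm by simp
    ultimately show "\<exists>\<tau>\<in>?G. enorm d (\<tau> - mean_point P) \<le> sqrt \<epsilon> * \<delta> + (1 + \<epsilon>) * L"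
      by (intro bexI[of _ \<tau>]) auto
  qed
qed simp

end
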